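(* (i) Let $1\le s\le d-1$ and let $(\mathbf A,\mathbf b)\in\mathbb R^{m\times(d+1)}$ be $s$-sparse affine phase retrievable for $\mathbb R^d$. Then $m\ge 2s+1$. (ii) Let $m\ge 2s+1$. Then a generic $(\mathbf A,\mathbf b)\in\mathbb R^{m\times(d+1)}$ is $s$-sparse affine phase retrievable for $\mathbb R^d$.
   Context: Write $(\mathbf A,\mathbf b)$ with $\mathbf A=(\mathbf a_1,\ldots,\mathbf a_m)^\top\in\mathbb R^{m\times d}$, $\mathbf b=(b_1,\ldots,b_m)^\top\in\mathbb R^m$, and $\mathbf M_{\mathbf A,\mathbf b}(\mathbf x)=(|\langle\mathbf a_1,\mathbf x\rangle+b_1|,\ldots,|\langle\mathbf a_m,\mathbf x\rangle+b_m|)$. Let $\Sigma_s(\mathbb R^d)=\{\mathbf x\in\mathbb R^d:\|\mathbf x\|_0\le s\}$, where $\|\mathbf x\|_0$ is the number of nonzero entries. $(\mathbf A,\mathbf b)$ is $s$-sparse affine phase retrievable for $\mathbb R^d$ if $\mathbf M_{\mathbf A,\mathbf b}$ is injective on $\Sigma_s(\mathbb R^d)$. A property holds for generic elements of $\mathbb R^N$ if it holds on a dense open set whose complement is a null set. *)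

theory Defs
  imports "HOL-Analysis.Analysis"
begin

definition sparse_vecs :: "nat \<Rightarrow> (real^'d) set" where
  "sparse_vecs s = {x. card {i. x $ i \<noteq> 0} \<le> s}"

definition affine_meas :: "real^'d^'m \<Rightarrow> real^'m \<Rightarrow> real^'d \<Rightarrow> real^'m" where
  "affine_meas A b x = (\<chi> i. \<bar>(A $ i) \<bullet> x + b $ i\<bar>)"

definition sparse_affine_pr :: "nat \<Rightarrow> real^'d^'m \<Rightarrow> real^'m \<Rightarrow> bool" where
  "sparse_affine_pr s A b \<longleftrightarrow> inj_on (affine_meas A b) (sparse_vecs s)"

definition generic :: "('a::euclidean_space \<Rightarrow> bool) \<Rightarrow> bool" where
  "generic P \<longleftrightarrow> (\<exists>U. open U \<and> closure U = UNIV \<and> (- U) \<in> null_sets lborel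
                     \<and> (\<forall>x\<in>U. P x))"

end

theory Submission
  imports Defs
begin

text \<open>
  Two points \<open>x\<close>, \<open>y\<close> have the same measurements iff, for some set \<open>T\<close> of rows, \<open>u = x - y\<close> and
  \<open>v = x + y\<close> satisfy the linear equations \<open>a\<^sub>i \<bullet> u = 0\<close> for \<open>i \<in> T\<close> and \<open>a\<^sub>i \<bullet> v + 2 b\<^sub>i = 0\<close> for
  \<open>i \<notin> T\<close>. With at least \<open>2s + 1\<close> rows this system is overdetermined for each of the finitely many
  choices of \<open>T\<close> and of the two supports; solutions in a suitable subspace are excluded generically
  as soon as a single \<open>(A, b)\<close> excludes them. With at most \<open>2s\<close> rows one can choose \<open>T\<close> and
  supports inside a set of \<open>s + 1\<close> coordinates such that a solution exists.
\<close>

section \<open>Null sets and generic properties\<close>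

text \<open>Eigenvectors chosen for distinct eigenvalues are independent, so the dimension bounds
  the number of eigenvalues.\<close>

lemma finite_eigenvalues:
  fixes f :: "'a::euclidean_space \<Rightarrow> 'a"
  assumes "linear f"
  shows "finite {c. \<exists>z. z \<noteq> 0 \<and> f z = c *\<^sub>R z}"
proof -
  define E where "E = {c. \<exists>z. z \<noteq> 0 \<and> f z = c *\<^sub>R z}"
  have "\<forall>c\<in>E. \<exists>z. z \<noteq> 0 \<and> f z = c *\<^sub>R z" by (simp add: E_def)
  then obtain z where z: "\<And>c. c \<in> E \<Longrightarrow> z c \<noteq> 0 \<and> f (z c) = c *\<^sub>R z c"
    by (metis (no_types, lifting) bchoice)
  have coeff: "\<forall>c\<in>C. a c = 0"
    if "finite C" "C \<subseteq> E" "(\<Sum>c\<in>C. a c *\<^sub>R z c) = 0" for C a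
    using that
  proof (induction C arbitrary: a rule: finite_induct)
    case empty
    then show ?case by simp
  next
    case (insert d C)
    have sum: "a d *\<^sub>R z d + (\<Sum>c\<in>C. a c *\<^sub>R z c) = 0"
      using insert by simp
    have "(\<Sum>c\<in>insert d C. (a c * c) *\<^sub>R z c) = f (\<Sum>c\<in>insert d C. a c *\<^sub>R z c)"
      unfolding linear_sum[OF assms] linear_scale[OF assms]
      using insert.prems(1) by (intro sum.cong) (use z in auto)
    also have "\<dots> = 0"
      using insert.prems(2) linear_0[OF assms] by (simp only:)
    finally have fsum: "(a d * d) *\<^sub>R z d + (\<Sum>c\<in>C. (a c * c) *\<^sub>R z c) = 0"
      using insert.hyps by simp
    \<comment> \<open>Applying \<open>f\<close> to the relation and subtracting \<open>d\<close>
      times the relation removes the term at \<open>d\<close>.\<close>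
    have "(\<Sum>c\<in>C. (a c * (c - d)) *\<^sub>R z c)
        = (\<Sum>c\<in>C. (a c * c) *\<^sub>R z c) - d *\<^sub>R (\<Sum>c\<in>C. a c *\<^sub>R z c)"
      by (simp add: scaleR_sum_right flip: sum_subtractf) (simp add: algebra_simps)
    also have "\<dots> = 0"
    proof -
      have 1: "(\<Sum>c\<in>C. a c *\<^sub>R z c) = - (a d *\<^sub>R z d)"
        using sum by (metis add_eq_0_iff)
      have 2: "(\<Sum>c\<in>C. (a c * c) *\<^sub>R z c) = - ((a d * d) *\<^sub>R z d)"
        using fsum by (metis add_eq_0_iff)
      show ?thesis unfolding 1 2 by (simp add: mult.commute)
    qed
    finally have "\<forall>c\<in>C. a c * (c - d) = 0"
      using insert.IH[of "\<lambda>c. a c * (c - d)"] insert.prems by blast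
    then have C: "\<forall>c\<in>C. a c = 0"
      using insert.hyps by auto
    then have "a d *\<^sub>R z d = 0" using sum by simp
    then show ?case using C z insert.prems by auto
  qed
  have inj: "inj_on z E"
  proof (rule inj_onI)
    fix c d assume *: "c \<in> E" "d \<in> E" "z c = z d"
    then have "c *\<^sub>R z c = d *\<^sub>R z c" using z by metis
    then show "c = d" using z * by auto
  qed
  have "independent (z ` E)"
    unfolding independent_explicit_module
  proof (intro allI impI)
    fix t u v assume t: "finite t" "t \<subseteq> z ` E" "(\<Sum>v\<in>t. u v *\<^sub>R v) = 0" "v \<in> t"
    then obtain C where C: "C \<subseteq> E" "t = z ` C" by (meson subset_imageE)
    have injC: "inj_on z C" using inj C(1) inj_on_subset by blast
    have fin: "finite C" using t(1) C finite_imageD injC by blast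
    have "(\<Sum>c\<in>C. u (z c) *\<^sub>R z c) = 0"
      using t(3) unfolding C(2) by (simp add: sum.reindex[OF injC])
    then have "\<forall>c\<in>C. u (z c) = 0" by (rule coeff[OF fin C(1)])
    then show "u v = 0" using t(4) C(2) by blast
  qed
  then have "finite (z ` E)" by (rule independent_imp_finite)
  then have "finite E" using inj finite_imageD by blast
  then show ?thesis by (simp add: E_def)
qed

text \<open>By Fubini and translation invariance: integrating the indicator of \<open>Z\<close> at
  \<open>x + c *\<^sub>R w\<close> over \<open>x\<close> gives the measure of \<open>Z\<close> for
  every \<open>c\<close>, while integrating it over \<open>c\<close> gives 0 for every
  \<open>x\<close>.\<close>

lemma null_sets_line:
  fixes Z :: "'a::euclidean_space set"
  assumes "closed Z" and line: "\<And>x. countable {c::real. x + c *\<^sub>R w \<in> Z}"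
  shows "Z \<in> null_sets lborel"
proof -
  have Z[measurable]: "Z \<in> sets borel" using assms by auto
  have trans: "(\<integral>\<^sup>+x. indicator Z (x + c *\<^sub>R w) \<partial>lborel) = emeasure lborel Z" for c :: real
  proof -
    have "emeasure lborel Z = (\<integral>\<^sup>+x. indicator Z x \<partial>(distr lborel borel ((+) (c *\<^sub>R w))))"
      unfolding lborel_distr_plus by simp
    also have "\<dots> = (\<integral>\<^sup>+x. indicator Z (c *\<^sub>R w + x) \<partial>lborel)"
      by (rule nn_integral_distr) auto
    finally show ?thesis by (simp add: add.commute)
  qed
  have zero: "(\<integral>\<^sup>+c. indicator Z (x + c *\<^sub>R w) \<partial>lborel) = 0" for x
  proof -
    have "(\<integral>\<^sup>+c. indicator Z (x + c *\<^sub>R w) \<partial>lborel)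
      = (\<integral>\<^sup>+c. indicator {c::real. x + c *\<^sub>R w \<in> Z} c \<partial>lborel)"
      by (intro nn_integral_cong) (auto simp: indicator_def)
    also have "\<dots> = emeasure lborel {c::real. x + c *\<^sub>R w \<in> Z}"
      by (intro nn_integral_indicator) simp
    also have "\<dots> = 0" by (rule emeasure_lborel_countable[OF line])
    finally show ?thesis .
  qed
  have "(\<integral>\<^sup>+(c::real). (\<integral>\<^sup>+x. indicator Z (x + c *\<^sub>R w) \<partial>lborel) \<partial>lborel)
      = (\<integral>\<^sup>+x. (\<integral>\<^sup>+(c::real). indicator Z (x + c *\<^sub>R w) \<partial>lborel) \<partial>lborel)"
    by (rule lborel_pair.Fubini') measurable
  then have "emeasure lborel Z * emeasure lborel (UNIV::real set) = 0"
    unfolding trans zero by simp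
  \<comment> \<open>The real line has infinite measure, so the vanishing product forces the measure
    of \<open>Z\<close> to be 0.\<close>
  then show ?thesis by auto
qed

text \<open>Density of the complement comes for free: a nonempty open set is not negligible, so a
  null set has empty interior.\<close>

lemma generic_avoid_closed:
  assumes "closed Z" "Z \<in> null_sets lborel" "\<And>x. x \<notin> Z \<Longrightarrow> P x"
  shows "generic P"
proof -
  have "negligible Z"
    using assms(2) by (simp add: negligible_iff_null_sets null_sets_completionI)
  then have "interior Z = {}"
    using open_not_negligible[OF open_interior, of Z] negligible_subset[OF _ interior_subset]
    by blast
  then show ?thesis
    unfolding generic_def
    using assms by (intro exI[of _ "-Z"]) (auto simp: closure_interior)
qed

lemma generic_mono:
  assumes "generic P" "\<And>x. P x \<Longrightarrow> Q x"
  shows "generic Q"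
  using assms unfolding generic_def by blast

lemma generic_all_finite:
  fixes P :: "'i::finite \<Rightarrow> 'a::euclidean_space \<Rightarrow> bool"
  assumes "\<And>i. generic (P i)"
  shows "generic (\<lambda>x. \<forall>i. P i x)"
proof -
  obtain U where U: "open (U i)" "- U i \<in> null_sets lborel" "\<forall>x\<in>U i. P i x" for i
    using assms unfolding generic_def by metis
  show ?thesis
  proof (rule generic_avoid_closed)
    show "closed (\<Union>i. - U i)" using U(1) by (intro closed_UN) auto
    show "(\<Union>i. - U i) \<in> null_sets lborel" using U(2) by (intro null_sets_UN') auto
  qed (use U(3) in auto)
qed

text \<open>On the line \<open>p + c w\<close> the degenerate parameters \<open>c\<close> are, up to sign, eigenvalues of
  \<open>g \<circ> L p\<close> with \<open>g\<close> a left inverse of \<open>L w\<close>, so every such line meets the bad set in a finite set.\<close>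

lemma generic_trivial_kernel:
  fixes L :: "'p::euclidean_space \<Rightarrow> 'n::euclidean_space \<Rightarrow> 'q::euclidean_space"
  assumes L: "bilinear L" and S: "subspace S"
    and w: "\<And>z. z \<in> S \<Longrightarrow> L w z = 0 \<Longrightarrow> z = 0"
  shows "generic (\<lambda>p. \<forall>z\<in>S. L p z = 0 \<longrightarrow> z = 0)"
proof -
  \<comment> \<open>Normalising \<open>z\<close> to unit length makes its range compact, so that
    \<open>Z\<close>, a projection of a closed set, is again closed.\<close>
  define Z where "Z = {p. \<exists>z. z \<in> sphere 0 1 \<inter> S \<and> (z, p) \<in> {(z, p). L p z = 0}}"
  have lin: "linear (L p)" for p using L by (simp add: bilinear_def)
  have "closed Z"
    unfolding Z_def
  proof (rule closed_compact_projection)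
    show "compact (sphere 0 1 \<inter> S)"
      using S by (intro compact_Int_closed closed_subspace) auto
    have "continuous_on UNIV (\<lambda>x. L (snd x) (fst x))"
      by (rule bilinear_continuous_on_compose[OF _ _ L]) (intro continuous_intros)+
    then show "closed {(z, p). L p z = 0}"
      using continuous_closed_preimage_constant[of UNIV "\<lambda>x. L (snd x) (fst x)" 0]
      by (simp add: case_prod_unfold)
  qed
  moreover have "Z \<in> null_sets lborel"
  proof (rule null_sets_line[OF \<open>closed Z\<close>, of w])
    fix p
    have "inj_on (L w) S"
      using w S by (simp add: linear_injective_on_subspace_0[OF lin])
    then obtain g where g: "linear g" "\<And>z. z \<in> S \<Longrightarrow> g (L w z) = z"
      using linear_exists_left_inverse_on[OF lin S, of w] by blast
    have "linear (g \<circ> L p)" using lin g(1) by (rule linear_compose)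
    then have "finite {c. \<exists>z. z \<noteq> 0 \<and> (g \<circ> L p) z = c *\<^sub>R z}"
      by (rule finite_eigenvalues)
    moreover have "{c. p + c *\<^sub>R w \<in> Z} \<subseteq> uminus ` {c. \<exists>z. z \<noteq> 0 \<and> (g \<circ> L p) z = c *\<^sub>R z}"
    proof
      fix c assume "c \<in> {c. p + c *\<^sub>R w \<in> Z}"
      then obtain z where z: "norm z = 1" "z \<in> S" "L (p + c *\<^sub>R w) z = 0"
        by (auto simp: Z_def)
      have "L p z + c *\<^sub>R L w z = 0"
        using z(3) by (simp add: bilinear_ladd[OF L] bilinear_lmul[OF L])
      then have "L p z = (- c) *\<^sub>R L w z" by (simp add: add_eq_0_iff2)
      then have "(g \<circ> L p) z = (- c) *\<^sub>R z"
        using g(2)[OF z(2)] by (simp only: o_def linear_scale[OF g(1)])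
      moreover have "z \<noteq> 0" using z(1) by auto
      ultimately have "- c \<in> {c. \<exists>z. z \<noteq> 0 \<and> (g \<circ> L p) z = c *\<^sub>R z}" by blast
      then show "c \<in> uminus ` {c. \<exists>z. z \<noteq> 0 \<and> (g \<circ> L p) z = c *\<^sub>R z}"
        by (rule rev_image_eqI) simp
    qed
    ultimately show "countable {c. p + c *\<^sub>R w \<in> Z}"
      by (meson countable_finite finite_imageI finite_subset)
  qed
  moreover have "\<forall>z\<in>S. L p z = 0 \<longrightarrow> z = 0" if "p \<notin> Z" for p
  proof (intro ballI impI, rule ccontr)
    fix z assume z: "z \<in> S" "L p z = 0" "z \<noteq> 0"
    have "sgn z \<in> sphere 0 1 \<inter> S"
      using z S by (auto simp: norm_sgn sgn_div_norm subspace_scale)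
    moreover have "L p (sgn z) = 0"
      using z linear_scale[OF lin] by (simp add: sgn_div_norm)
    ultimately show False using that unfolding Z_def by blast
  qed
  ultimately show ?thesis by (rule generic_avoid_closed)
qed

section \<open>The linear system satisfied by colliding points\<close>

text \<open>The unknown \<open>t\<close> homogenises the inhomogeneous equations, so that the system
  is linear in \<open>(u, v, t)\<close> as well as in \<open>(A, b)\<close>; collisions appear at
  \<open>t = 2\<close>.\<close>

definition row_system ::
    "'m set \<Rightarrow> (real^'d^'m) \<times> (real^'m) \<Rightarrow> (real^'d) \<times> (real^'d) \<times> real \<Rightarrow> real^'m" where
  "row_system T = (\<lambda>(A, b) (u, v, t). \<chi> i. if i \<in> T then A $ i \<bullet> u else A $ i \<bullet> v + t * b $ i)"

lemma bilinear_row_system: "bilinear (row_system T)"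
  unfolding bilinear_def
  by (auto intro!: linearI simp: row_system_def vec_eq_iff algebra_simps)

lemma row_system_eq_0:
  "row_system T (A, b) (u, v, t) = 0 \<longleftrightarrow>
     (\<forall>i\<in>T. A $ i \<bullet> u = 0) \<and> (\<forall>i. i \<notin> T \<longrightarrow> A $ i \<bullet> v + t * b $ i = 0)"
  by (auto simp: row_system_def vec_eq_iff split: if_splits)

text \<open>In \<open>K2\<close> the index \<open>None\<close> stands for the unknown \<open>t\<close>.\<close>

lemma row_system_witness:
  fixes T :: "'m::finite set" and K1 :: "'d::finite set" and K2 :: "'d option set"
  assumes "card K1 \<le> card T" "card K2 \<le> card (- T)"
  obtains A :: "real^'d^'m" and b :: "real^'m"
  where "\<And>u v t. row_system T (A, b) (u, v, t) = 0 \<Longrightarrow>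
    (\<forall>j\<in>K1. u $ j = 0) \<and> (\<forall>j. Some j \<in> K2 \<longrightarrow> v $ j = 0) \<and> (None \<in> K2 \<longrightarrow> t = 0)"
proof -
  obtain f where f: "f ` K1 \<subseteq> T" "inj_on f K1"
    using card_le_inj[of K1 T] assms(1) by auto
  obtain g where g: "g ` K2 \<subseteq> - T" "inj_on g K2"
    using card_le_inj[of K2 "- T"] assms(2) by auto
  \<comment> \<open>Row \<open>f j\<close> reads off \<open>u $ j\<close>, row
    \<open>g (Some j)\<close> reads off \<open>v $ j\<close> and row \<open>g None\<close> reads off
    \<open>t\<close>. Rows outside the images of \<open>f\<close> and \<open>g\<close> get
    unspecified entries and can only add equations.\<close>
  define A :: "real^'d^'m" where "A = (\<chi> i. if i \<in> T then axis (inv_into K1 f i) 1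
    else (case inv_into K2 g i of Some j \<Rightarrow> axis j 1 | None \<Rightarrow> 0))"
  define b :: "real^'m" where
    "b = (\<chi> i. case inv_into K2 g i of Some j \<Rightarrow> 0 | None \<Rightarrow> 1)"
  show ?thesis
  proof (rule that[of A b], intro conjI allI ballI impI)
    fix u v t assume *: "row_system T (A, b) (u, v, t) = 0"
    show "u $ j = 0" if "j \<in> K1" for j
    proof -
      have "f j \<in> T" using that f by auto
      then have "A $ f j \<bullet> u = 0" using * by (simp add: row_system_eq_0)
      then show ?thesis
        using \<open>f j \<in> T\<close> that f(2) by (simp add: A_def inner_axis')
    qed
    show "v $ j = 0" if "Some j \<in> K2" for j
    proof -
      have "g (Some j) \<notin> T" using that g by auto
      then have "A $ g (Some j) \<bullet> v + t * b $ g (Some j) = 0" using * by (simp add: row_system_eq_0)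
      then show ?thesis
        using \<open>g (Some j) \<notin> T\<close> that g(2) by (simp add: A_def b_def inner_axis')
    qed
    show "t = 0" if "None \<in> K2"
    proof -
      have "g None \<notin> T" using that g by auto
      then have "A $ g None \<bullet> v + t * b $ g None = 0" using * by (simp add: row_system_eq_0)
      then show ?thesis
        using \<open>g None \<notin> T\<close> that g(2) by (simp add: A_def b_def)
    qed
  qed
qed

text \<open>By \<open>K\<close>, the coordinates listed in \<open>K1\<close> and \<open>K2\<close>
  determine a point of \<open>S\<close>. Genericity becomes a matter of counting: these coordinates
  have to fit into the rows inside and outside \<open>T\<close>.\<close>

lemma generic_row_system:
  fixes T :: "'m::finite set" and K1 :: "'d::finite set" and K2 :: "'d option set"
  assumes "card K1 \<le> card T" "card K2 \<le> card (- T)" and S: "subspace S"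
    and K: "\<And>u v t. (u, v, t) \<in> S \<Longrightarrow> \<forall>j\<in>K1. u $ j = 0 \<Longrightarrow> \<forall>j. Some j \<in> K2 \<longrightarrow> v $ j = 0 \<Longrightarrow>
      (None \<in> K2 \<longrightarrow> t = 0) \<Longrightarrow> u = 0 \<and> v = 0 \<and> t = 0"
  shows "generic (\<lambda>p :: (real^'d^'m) \<times> (real^'m). \<forall>z\<in>S. row_system T p z = 0 \<longrightarrow> z = 0)"
proof -
  obtain A :: "real^'d^'m" and b :: "real^'m" where
    w: "\<And>u v t. row_system T (A, b) (u, v, t) = 0 \<Longrightarrow>
      (\<forall>j\<in>K1. u $ j = 0) \<and> (\<forall>j. Some j \<in> K2 \<longrightarrow> v $ j = 0) \<and> (None \<in> K2 \<longrightarrow> t = 0)"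
    using row_system_witness[OF assms(1,2)] by blast
  show ?thesis
  proof (rule generic_trivial_kernel[OF bilinear_row_system S])
    fix z assume z: "z \<in> S" "row_system T (A, b) z = 0"
    obtain u v t where "z = (u, v, t)" by (cases z)
    then show "z = 0" using w[of u v t] K[of u v t] z by (simp add: zero_prod_def)
  qed
qed

section \<open>Generic injectivity on sparse vectors\<close>

text \<open>Before taking absolute values, the rows in \<open>T\<close> give equal values at
  \<open>x\<close> and \<open>y\<close>, the others opposite values. A row with both values 0 may be
  on either side.\<close>

definition collision :: "'m set \<Rightarrow> real^'d^'m \<Rightarrow> real^'m \<Rightarrow> real^'d \<Rightarrow> real^'d \<Rightarrow> bool" where
  "collision T A b x y \<longleftrightarrow>
     x \<noteq> y \<and> (\<forall>i\<in>T. A $ i \<bullet> (x - y) = 0) \<and> (\<forall>i. i \<notin> T \<longrightarrow> A $ i \<bullet> (x + y) + 2 * b $ i = 0)"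

lemma affine_meas_eq_iff_collision:
  "x \<noteq> y \<and> affine_meas A b x = affine_meas A b y \<longleftrightarrow> (\<exists>T. collision T A b x y)"
proof
  assume *: "x \<noteq> y \<and> affine_meas A b x = affine_meas A b y"
  then have "\<bar>A $ i \<bullet> x + b $ i\<bar> = \<bar>A $ i \<bullet> y + b $ i\<bar>" for i
    by (simp add: affine_meas_def vec_eq_iff)
  then have "A $ i \<bullet> (x - y) = 0 \<or> A $ i \<bullet> (x + y) + 2 * b $ i = 0" for i
    unfolding inner_right_distrib inner_diff_right by (smt (verit))
  then have "collision {i. A $ i \<bullet> (x - y) = 0} A b x y"
    using * unfolding collision_def by blast
  then show "\<exists>T. collision T A b x y" ..
next
  assume "\<exists>T. collision T A b x y"
  then obtain T where T: "collision T A b x y" ..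
  have "\<bar>A $ i \<bullet> x + b $ i\<bar> = \<bar>A $ i \<bullet> y + b $ i\<bar>" for i
  proof (cases "i \<in> T")
    case True
    then show ?thesis using T by (simp add: collision_def inner_diff_right)
  next
    case False
    then have "A $ i \<bullet> x + A $ i \<bullet> y + 2 * b $ i = 0"
      using T by (simp add: collision_def inner_right_distrib)
    then have "A $ i \<bullet> x + b $ i = - (A $ i \<bullet> y + b $ i)" by linarith
    then show ?thesis by simp
  qed
  then show "x \<noteq> y \<and> affine_meas A b x = affine_meas A b y"
    using T by (simp add: affine_meas_def vec_eq_iff collision_def)
qed

lemma row_system_collision:
  "collision T A b x y \<Longrightarrow> row_system T (A, b) (x - y, x + y, 2) = 0"
  by (simp add: row_system_eq_0 collision_def)

text \<open>With \<open>u = x - y\<close> and \<open>v = x + y\<close>: for large \<open>T\<close> the rows in \<open>T\<close> force \<open>u = 0\<close>; for small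
  \<open>T\<close> the remaining rows are already overdetermined in \<open>v\<close>; in between, both groups are needed.\<close>

lemma generic_no_collision:
  fixes T :: "'m::finite set" and I J :: "'d::finite set"
  assumes m: "CARD('m) > card I + card J"
  shows "generic (\<lambda>(A :: real^'d^'m, b :: real^'m).
    \<forall>x y. (\<forall>j. j \<notin> I \<longrightarrow> x $ j = 0) \<and> (\<forall>j. j \<notin> J \<longrightarrow> y $ j = 0) \<longrightarrow> \<not> collision T A b x y)"
proof -
  have compl: "card (- T) = CARD('m) - card T" by (simp add: Compl_eq_Diff_UNIV card_Diff_subset)
  have IJ: "card (I \<union> J) + card (I \<inter> J) = card I + card J"
    by (simp add: card_Un_Int[symmetric])
  have le_m: "card T \<le> CARD('m)" by (simp add: card_mono)
  \<comment> \<open>The three cases end alike: a collision solves the row system, and what remains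
    is to choose a subspace \<open>S\<close> whose trivial kernel forces
    \<open>x = y\<close>.\<close>
  have *: ?thesis
    if gen: "generic (\<lambda>p :: (real^'d^'m) \<times> (real^'m). \<forall>z\<in>S. row_system T p z = 0 \<longrightarrow> z = 0)"
      and sep: "\<And>A b x y. \<lbrakk>\<forall>z\<in>S. row_system T (A :: real^'d^'m, b) z = 0 \<longrightarrow> z = 0;
        \<forall>j. j \<notin> I \<longrightarrow> x $ j = 0; \<forall>j. j \<notin> J \<longrightarrow> y $ j = 0;
        row_system T (A, b) (x - y, x + y, 2) = 0\<rbrakk> \<Longrightarrow> x = y" for S
    using gen
  proof (rule generic_mono)
    fix p :: "(real^'d^'m) \<times> (real^'m)"
    assume ker: "\<forall>z\<in>S. row_system T p z = 0 \<longrightarrow> z = 0"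
    obtain A b where p: "p = (A, b)" by (cases p)
    have "\<not> collision T A b x y"
      if xy: "\<forall>j. j \<notin> I \<longrightarrow> x $ j = 0" "\<forall>j. j \<notin> J \<longrightarrow> y $ j = 0" for x y
    proof
      assume col: "collision T A b x y"
      then have "x = y" using sep[OF ker[unfolded p] xy] row_system_collision by blast
      then show False using col by (simp add: collision_def)
    qed
    then show "case p of (A, b) \<Rightarrow> \<forall>x y. (\<forall>j. j \<notin> I \<longrightarrow> x $ j = 0) \<and> (\<forall>j. j \<notin> J \<longrightarrow> y $ j = 0) \<longrightarrow>
      \<not> collision T A b x y"
      by (simp add: p)
  qed
  consider (large) "card (I \<union> J) \<le> card T" | (small) "card T \<le> card (I \<inter> J)"
    | (medium) "card (I \<inter> J) \<le> card T" "card T \<le> card (I \<union> J)"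
    by linarith
  then show ?thesis
  proof cases
    case large
    let ?S = "{(u, v, t). (\<forall>j. j \<notin> I \<union> J \<longrightarrow> u $ j = 0) \<and> v = 0 \<and> t = 0}
      :: ((real^'d) \<times> (real^'d) \<times> real) set"
    show ?thesis
    proof (rule *[of ?S])
      show "generic (\<lambda>p :: (real^'d^'m) \<times> (real^'m). \<forall>z\<in>?S. row_system T p z = 0 \<longrightarrow> z = 0)"
        by (rule generic_row_system[of "I \<union> J" T "{}"])
          (use large in \<open>auto simp: subspace_def zero_prod_def vec_eq_iff\<close>)
      fix A b and x y :: "real^'d"
      assume ker: "\<forall>z\<in>?S. row_system T (A :: real^'d^'m, b) z = 0 \<longrightarrow> z = 0"
        and xy: "\<forall>j. j \<notin> I \<longrightarrow> x $ j = 0" "\<forall>j. j \<notin> J \<longrightarrow> y $ j = 0"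
          "row_system T (A, b) (x - y, x + y, 2) = 0"
      have "(x - y, 0, 0) \<in> ?S" using xy by auto
      moreover have "row_system T (A, b) (x - y, 0, 0) = 0"
        using xy(3) by (simp add: row_system_eq_0)
      ultimately have "(x - y, 0, 0) = (0 :: (real^'d) \<times> (real^'d) \<times> real)" using ker by blast
      then show "x = y" by (simp add: zero_prod_def)
    qed
  next
    case small
    let ?S = "{(u, v, t). (\<forall>j. j \<notin> I \<union> J \<longrightarrow> v $ j = 0) \<and> u = 0}
      :: ((real^'d) \<times> (real^'d) \<times> real) set"
    let ?K = "insert None (Some ` (I \<union> J))"
    have K: "card ?K = card (I \<union> J) + 1" by (simp add: card_image)
    show ?thesis
    proof (rule *[of ?S])
      show "generic (\<lambda>p :: (real^'d^'m) \<times> (real^'m). \<forall>z\<in>?S. row_system T p z = 0 \<longrightarrow> z = 0)"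
      proof (rule generic_row_system[of "{}" T ?K])
        show "card ?K \<le> card (- T)"
          using small m IJ le_m unfolding K compl by linarith
      qed (auto simp: subspace_def zero_prod_def vec_eq_iff)
      fix A b and x y :: "real^'d"
      assume ker: "\<forall>z\<in>?S. row_system T (A :: real^'d^'m, b) z = 0 \<longrightarrow> z = 0"
        and xy: "\<forall>j. j \<notin> I \<longrightarrow> x $ j = 0" "\<forall>j. j \<notin> J \<longrightarrow> y $ j = 0"
          "row_system T (A, b) (x - y, x + y, 2) = 0"
      \<comment> \<open>The conclusion \<open>x = y\<close> comes out of the contradiction
        \<open>2 = 0\<close>: no pair solves the system at all.\<close>
      have "(0, x + y, 2) \<in> ?S" using xy by auto
      moreover have "row_system T (A, b) (0, x + y, 2) = 0"
        using xy(3) by (simp add: row_system_eq_0)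
      ultimately have "(0, x + y, 2) = (0 :: (real^'d) \<times> (real^'d) \<times> real)" using ker by blast
      then show "x = y" by (simp add: zero_prod_def)
    qed
  next
    case medium
    \<comment> \<open>Membership encodes the two supports: \<open>u + v\<close> stands for twice
      \<open>x\<close> and vanishes off \<open>I\<close>, \<open>v - u\<close> stands for twice
      \<open>y\<close> and vanishes off \<open>J\<close>.\<close>
    let ?S = "{(u, v, t). (\<forall>j. j \<notin> I \<longrightarrow> u $ j + v $ j = 0) \<and> (\<forall>j. j \<notin> J \<longrightarrow> v $ j - u $ j = 0)}
      :: ((real^'d) \<times> (real^'d) \<times> real) set"
    \<comment> \<open>On \<open>I \<inter> J\<close> the entries of \<open>u\<close> and
      \<open>v\<close> are independent; on the rest of \<open>I \<union> J\<close> they agree up to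
      sign, so one of them suffices. The rows in \<open>T\<close> control \<open>u\<close> on
      \<open>K\<close>, the other rows control \<open>t\<close> and the remaining entries of
      \<open>v\<close>.\<close>
    obtain K where K: "I \<inter> J \<subseteq> K" "K \<subseteq> I \<union> J" "card K = card T"
      using exists_subset_between[OF medium] by auto
    let ?K' = "insert None (Some ` ((I \<inter> J) \<union> ((I \<union> J) - K)))"
    have "card ?K' = card ((I \<inter> J) \<union> ((I \<union> J) - K)) + 1" by (simp add: card_image)
    also have "card ((I \<inter> J) \<union> ((I \<union> J) - K)) = card (I \<inter> J) + card ((I \<union> J) - K)"
      using K by (intro card_Un_disjoint) auto
    also have "card ((I \<union> J) - K) = card (I \<union> J) - card T"
      using K by (simp add: card_Diff_subset)
    finally have K': "card ?K' = card (I \<inter> J) + (card (I \<union> J) - card T) + 1" .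
    show ?thesis
    proof (rule *[of ?S])
      show "generic (\<lambda>p :: (real^'d^'m) \<times> (real^'m). \<forall>z\<in>?S. row_system T p z = 0 \<longrightarrow> z = 0)"
      proof (rule generic_row_system[of K T ?K'])
        \<comment> \<open>Together with \<open>card T\<close> the count is
          \<open>card I + card J + 1\<close>, exactly what \<open>m\<close> provides.\<close>
        show "card ?K' \<le> card (- T)"
          using medium m IJ le_m unfolding K' compl by linarith
        fix u v :: "real^'d" and t
        assume S: "(u, v, t) \<in> ?S" and u: "\<forall>j\<in>K. u $ j = 0"
          and v: "\<forall>j. Some j \<in> ?K' \<longrightarrow> v $ j = 0" and t: "None \<in> ?K' \<longrightarrow> t = 0"
        have "u $ j = 0 \<and> v $ j = 0" for j
          using S u v K(1,2) by (cases "j \<in> I"; cases "j \<in> J"; cases "j \<in> K") force+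
        then show "u = 0 \<and> v = 0 \<and> t = 0" using t by (simp add: vec_eq_iff)
      qed (use K in \<open>auto simp: subspace_def zero_prod_def algebra_simps simp flip: distrib_left right_diff_distrib\<close>)
      fix A b and x y :: "real^'d"
      assume ker: "\<forall>z\<in>?S. row_system T (A :: real^'d^'m, b) z = 0 \<longrightarrow> z = 0"
        and xy: "\<forall>j. j \<notin> I \<longrightarrow> x $ j = 0" "\<forall>j. j \<notin> J \<longrightarrow> y $ j = 0"
          "row_system T (A, b) (x - y, x + y, 2) = 0"
      have "(x - y, x + y, 2) \<in> ?S" using xy by auto
      then have "(x - y, x + y, 2) = (0 :: (real^'d) \<times> (real^'d) \<times> real)" using ker xy(3) by blast
      then show "x = y" by (simp add: zero_prod_def)
    qed
  qed
qed

text \<open>Sparse vectors fill finitely many coordinate subspaces, so only finitely many generic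
  conditions, one for each triple \<open>(T, I, J)\<close>, are combined.\<close>

lemma generic_sparse_affine_pr:
  assumes "CARD('m::finite) \<ge> 2 * s + 1"
  shows "generic (\<lambda>(A :: real^'d^'m, b :: real^'m). sparse_affine_pr s A b)"
proof -
  have "generic (\<lambda>p. \<forall>k. (\<lambda>(T, I, J) (A :: real^'d^'m, b :: real^'m).
    card I \<le> s \<and> card J \<le> s \<longrightarrow>
    (\<forall>x y. (\<forall>j. j \<notin> I \<longrightarrow> x $ j = 0) \<and> (\<forall>j. j \<notin> J \<longrightarrow> y $ j = 0) \<longrightarrow> \<not> collision T A b x y)) k p)"
  proof (rule generic_all_finite)
    fix k :: "'m set \<times> 'd set \<times> 'd set"
    obtain T I J where k: "k = (T, I, J)" by (cases k)
    show "generic ((\<lambda>(T, I, J) (A :: real^'d^'m, b :: real^'m). card I \<le> s \<and> card J \<le> s \<longrightarrow>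
      (\<forall>x y. (\<forall>j. j \<notin> I \<longrightarrow> x $ j = 0) \<and> (\<forall>j. j \<notin> J \<longrightarrow> y $ j = 0) \<longrightarrow> \<not> collision T A b x y)) k)"
    proof (cases "card I \<le> s \<and> card J \<le> s")
      case True
      then have "card I + card J < CARD('m)" using assms by linarith
      from generic_no_collision[OF this, of T] show ?thesis using True by (simp add: k)
    next
      case False
      have "generic (\<lambda>_ :: (real^'d^'m) \<times> (real^'m). True)"
        by (rule generic_avoid_closed[of "{}"]) auto
      then show ?thesis by (rule generic_mono) (use False in \<open>auto simp: k case_prod_unfold\<close>)
    qed
  qed
  then show ?thesis
  proof (rule generic_mono, clarify)
    fix A b
    assume *: "\<forall>k. (\<lambda>(T, I, J) (A :: real^'d^'m, b :: real^'m). card I \<le> s \<and> card J \<le> s \<longrightarrow>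
      (\<forall>x y. (\<forall>j. j \<notin> I \<longrightarrow> x $ j = 0) \<and> (\<forall>j. j \<notin> J \<longrightarrow> y $ j = 0) \<longrightarrow> \<not> collision T A b x y)) k (A, b)"
    show "sparse_affine_pr s A b"
      unfolding sparse_affine_pr_def
    proof (rule inj_onI, rule ccontr)
      fix x y assume xy: "x \<in> sparse_vecs s" "y \<in> sparse_vecs s"
        "affine_meas A b x = affine_meas A b y" "x \<noteq> y"
      then obtain T where "collision T A b x y"
        using affine_meas_eq_iff_collision by blast
      then show False
        using *[rule_format, of "(T, {i. x $ i \<noteq> 0}, {i. y $ i \<noteq> 0})"] xy(1,2)
        by (simp add: sparse_vecs_def)
    qed
  qed
qed

section \<open>Failure of injectivity for at most \<open>2 * s\<close> rows\<close>

text \<open>Vanishing off \<open>H\<close> is orthogonality to the coordinate vectors outside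
  \<open>H\<close>; together with \<open>F\<close> these are fewer vectors than the
  dimension.\<close>

lemma exists_supported_orthogonal:
  fixes F :: "(real^'d) set"
  assumes "finite F" "card F < card H"
  obtains u where "u \<noteq> 0" "\<forall>j. j \<notin> H \<longrightarrow> u $ j = 0" "\<forall>f\<in>F. f \<bullet> u = 0"
proof -
  let ?F = "F \<union> (\<lambda>j. axis j 1) ` (- H)"
  have "dim ?F \<le> card ?F" using assms(1) by (intro dim_le_card') auto
  also have "\<dots> \<le> card F + card ((\<lambda>j. axis j 1 :: real^'d) ` (- H))" by (rule card_Un_le)
  also have "\<dots> \<le> card F + (CARD('d) - card H)"
    using card_image_le[of "- H" "\<lambda>j. axis j 1 :: real^'d"]
    by (simp add: Compl_eq_Diff_UNIV card_Diff_subset)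
  also have "\<dots> < DIM(real^'d)"
    using assms(2) card_mono[of UNIV H] by simp
  finally have "dim ?F < DIM(real^'d)" .
  then obtain u where u: "u \<noteq> 0" "\<And>f. f \<in> span ?F \<Longrightarrow> orthogonal u f"
    using orthogonal_to_subspace_exists[of ?F] by blast
  have F: "f \<bullet> u = 0" if "f \<in> ?F" for f
    using u(2)[OF span_base[OF that]] by (simp add: orthogonal_def inner_commute)
  show ?thesis
  proof (rule that[OF u(1)])
    show "\<forall>j. j \<notin> H \<longrightarrow> u $ j = 0"
      using F[of "axis _ 1"] by (auto simp: inner_axis')
  qed (use F in auto)
qed

text \<open>The coordinate vectors outside \<open>H\<close> extend by rows of \<open>A\<close> to a
  basis. The added rows number \<open>card H\<close>, and a linear functional may be prescribed on a
  basis.\<close>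

lemma exists_interpolating_rows:
  fixes A :: "real^'d^'m"
  assumes inj: "\<And>w. \<forall>j. j \<notin> H \<longrightarrow> w $ j = 0 \<Longrightarrow> \<forall>i. A $ i \<bullet> w = 0 \<Longrightarrow> w = 0"
  obtains R v where "card R = card H" "\<forall>j. j \<notin> H \<longrightarrow> v $ j = 0" "\<forall>i\<in>R. A $ i \<bullet> v = c i"
proof -
  let ?E = "(\<lambda>j. axis j 1 :: real^'d) ` (- H)"
  have "pairwise orthogonal ?E"
    by (auto simp: pairwise_def orthogonal_def inner_axis_axis)
  then have "independent ?E"
    by (rule pairwise_orthogonal_independent) (auto simp: axis_eq_0_iff)
  then obtain B where B: "?E \<subseteq> B" "B \<subseteq> ?E \<union> range (($) A)" "independent B"
    "?E \<union> range (($) A) \<subseteq> span B"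
    using maximal_independent_subset_extend[of ?E "?E \<union> range (($) A)"] by auto
  \<comment> \<open>A nonzero vector orthogonal to \<open>B\<close> would be supported in
    \<open>H\<close> and annihilated by all rows, against \<open>inj\<close>.\<close>
  have "span B = UNIV"
  proof (rule ccontr)
    assume "span B \<noteq> UNIV"
    then obtain w where w: "w \<noteq> 0" "\<And>f. f \<in> span B \<Longrightarrow> orthogonal w f"
      using orthogonal_to_subspace_exists_gen[of B UNIV] by auto
    have F: "f \<bullet> w = 0" if "f \<in> ?E \<union> range (($) A)" for f
      using w(2)[of f] B(4) that by (auto simp: orthogonal_def inner_commute)
    have "\<forall>j. j \<notin> H \<longrightarrow> w $ j = 0"
      using F[of "axis _ 1"] by (auto simp: inner_axis')
    moreover have "\<forall>i. A $ i \<bullet> w = 0" using F by auto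
    ultimately show False using inj w(1) by blast
  qed
  then have "card B = CARD('d)"
    using B(3) basis_card_eq_dim[of B UNIV] by simp
  moreover have "card ?E = CARD('d) - card H"
    by (subst card_image) (auto simp: inj_on_def axis_eq_axis Compl_eq_Diff_UNIV card_Diff_subset)
  moreover have "card H \<le> CARD('d)" by (simp add: card_mono)
  ultimately have cB: "card (B - ?E) = card H"
    using B(1) by (subst card_Diff_subset) auto
  have "B - ?E \<subseteq> range (($) A)" using B(2) by blast
  then have "\<exists>R\<subseteq>UNIV. inj_on (($) A) R \<and> B - ?E = ($) A ` R"
    by (rule subset_image_inj[THEN iffD1])
  then obtain R where R: "inj_on (($) A) R" "B - ?E = ($) A ` R" by blast
  obtain f :: "real^'d \<Rightarrow> real" where f: "linear f"
    "\<forall>x\<in>B. f x = (if x \<in> ?E then 0 else c (inv_into R (($) A) x))"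
    using linear_independent_extend[OF B(3), of "\<lambda>x. if x \<in> ?E then 0 else c (inv_into R (($) A) x)"]
    by blast
  \<comment> \<open>\<open>adjoint f 1\<close> is the vector representing the functional
    \<open>f\<close>.\<close>
  have inner: "x \<bullet> adjoint f 1 = f x" for x
    using adjoint_works[OF f(1), of x 1] by simp
  show ?thesis
  proof (rule that[of R "adjoint f 1"])
    show "card R = card H" using cB R by (simp add: card_image)
    show "\<forall>j. j \<notin> H \<longrightarrow> adjoint f 1 $ j = 0"
    proof (intro allI impI)
      fix j assume "j \<notin> H"
      then have "f (axis j 1) = 0" using f(2) B(1) by auto
      then show "adjoint f 1 $ j = 0" using inner[of "axis j 1"] by (simp add: inner_axis')
    qed
    show "\<forall>i\<in>R. A $ i \<bullet> adjoint f 1 = c i"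
    proof
      fix i assume i: "i \<in> R"
      then have "A $ i \<in> B - ?E" using R(2) by auto
      then have "f (A $ i) = c (inv_into R (($) A) (A $ i))" using f(2) by auto
      then show "A $ i \<bullet> adjoint f 1 = c i" using inner R(1) i by simp
    qed
  qed
qed

lemma sparse_vecsI:
  assumes "card H \<le> s + 1" "j \<in> H" "x $ j = 0" "\<forall>k. k \<notin> H \<longrightarrow> x $ k = 0"
  shows "x \<in> sparse_vecs s"
proof -
  have "{i. x $ i \<noteq> 0} \<subseteq> H - {j}" using assms by auto
  then have "card {i. x $ i \<noteq> 0} \<le> card (H - {j})" by (intro card_mono) auto
  then show ?thesis using assms by (simp add: sparse_vecs_def)
qed

text \<open>Choose \<open>s + 1\<close> coordinates \<open>H\<close>. Once \<open>s + 1\<close> rows determine \<open>v = x + y\<close> on \<open>H\<close>, the at most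
  \<open>s - 1\<close> remaining rows leave at least two degrees of freedom for \<open>u = x - y\<close> on \<open>H\<close>. These are used
  up by \<open>u\<^sub>j = - v\<^sub>j\<close> and \<open>u\<^sub>k = v\<^sub>k\<close>, which make \<open>x\<^sub>j\<close> and \<open>y\<^sub>k\<close> vanish.\<close>

lemma not_sparse_affine_pr:
  fixes A :: "real^'d^'m"
  assumes s: "1 \<le> s" "s < CARD('d)" and m: "CARD('m) \<le> 2 * s"
  shows "\<not> sparse_affine_pr s A b"
proof -
  obtain H :: "'d set" where H: "card H = s + 1"
    using obtain_subset_with_card_n[of "s + 1" "UNIV :: 'd set"] s(2) by auto
  have *: ?thesis if "collision T A b x y" "x \<in> sparse_vecs s" "y \<in> sparse_vecs s" for T x y
    using that affine_meas_eq_iff_collision[of x y A b]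
    unfolding sparse_affine_pr_def inj_on_def by blast
  show ?thesis
  proof (cases "\<exists>w. w \<noteq> 0 \<and> (\<forall>j. j \<notin> H \<longrightarrow> w $ j = 0) \<and> (\<forall>i. A $ i \<bullet> w = 0)")
    case True
    then obtain w where w: "w \<noteq> 0" "\<forall>j. j \<notin> H \<longrightarrow> w $ j = 0" "\<forall>i. A $ i \<bullet> w = 0" by blast
    then obtain j where j: "w $ j \<noteq> 0" by (auto simp: vec_eq_iff)
    then have "j \<in> H" using w(2) by auto
    obtain k where k: "k \<in> H" "k \<noteq> j"
    proof -
      have "card (H - {j}) \<noteq> 0" using H s(1) \<open>j \<in> H\<close> by simp
      then have "H - {j} \<noteq> {}" by fastforce
      then show ?thesis using that by blast
    qed
    show ?thesis
    \<comment> \<open>The difference of the two points is \<open>w\<close>, so all rows agree,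
      whatever \<open>b\<close> is. The first point vanishes at \<open>j\<close>; the second has its
      only entry at \<open>j\<close> and vanishes at \<open>k\<close>.\<close>
    proof (rule *[of UNIV "w - axis j (w $ j)" "- axis j (w $ j)"])
      show "collision UNIV A b (w - axis j (w $ j)) (- axis j (w $ j))"
        using w by (simp add: collision_def)
      show "w - axis j (w $ j) \<in> sparse_vecs s"
        by (rule sparse_vecsI[of H _ j]) (use w H \<open>j \<in> H\<close> in \<open>auto simp: axis_def\<close>)
      show "- axis j (w $ j) \<in> sparse_vecs s"
        by (rule sparse_vecsI[of H _ k]) (use k H \<open>j \<in> H\<close> in \<open>auto simp: axis_def\<close>)
    qed
  next
    case False
    then obtain R v where R: "card R = s + 1" and v: "\<forall>j. j \<notin> H \<longrightarrow> v $ j = 0"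
      "\<forall>i\<in>R. A $ i \<bullet> v = - 2 * b $ i"
      using exists_interpolating_rows[of H A "\<lambda>i. - 2 * b $ i"] H by metis
    define F where "F = ($) A ` (- R)"
    have F: "finite F" "card F + 1 < card H"
    proof -
      have "card F \<le> card (- R)" unfolding F_def by (rule card_image_le) simp
      also have "\<dots> \<le> s - 1" using R m by (simp add: Compl_eq_Diff_UNIV card_Diff_subset)
      finally show "card F + 1 < card H" using H s(1) by linarith
    qed (simp add: F_def)
    have collide: ?thesis
      if "u \<noteq> 0" "\<forall>i. i \<notin> H \<longrightarrow> u $ i = 0" "\<forall>f\<in>F. f \<bullet> u = 0"
        and "j \<in> H" "k \<in> H" "u $ j = - v $ j" "u $ k = v $ k" for u j k
    proof (rule *[of "- R" "(1/2) *\<^sub>R (v + u)" "(1/2) *\<^sub>R (v - u)"])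
      have diff: "(1/2) *\<^sub>R (v + u) - (1/2) *\<^sub>R (v - u) = u"
        and sum: "(1/2) *\<^sub>R (v + u) + (1/2) *\<^sub>R (v - u) = v"
        by (simp_all add: vec_eq_iff field_simps)
      have "(1/2) *\<^sub>R (v + u) \<noteq> (1/2) *\<^sub>R (v - u)" using diff that(1) by force
      then show "collision (- R) A b ((1/2) *\<^sub>R (v + u)) ((1/2) *\<^sub>R (v - u))"
        unfolding collision_def diff sum using that(3) v(2) by (simp add: F_def)
      show "(1/2) *\<^sub>R (v + u) \<in> sparse_vecs s"
        by (rule sparse_vecsI[of H _ j]) (use that v H in auto)
      show "(1/2) *\<^sub>R (v - u) \<in> sparse_vecs s"
        by (rule sparse_vecsI[of H _ k]) (use that v H in auto)
    qed
    obtain u1 where u1: "u1 \<noteq> 0" "\<forall>i. i \<notin> H \<longrightarrow> u1 $ i = 0" "\<forall>f\<in>F. f \<bullet> u1 = 0"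
      using exists_supported_orthogonal[of F H] F by auto
    obtain j where j: "u1 $ j \<noteq> 0" using u1(1) by (auto simp: vec_eq_iff)
    then have "j \<in> H" using u1(2) by auto
    \<comment> \<open>Requiring \<open>u2 $ j = 0\<close> makes the conditions at \<open>j\<close>
      and \<open>k\<close> triangular: \<open>u1\<close> is scaled to meet the one at
      \<open>j\<close>, then \<open>u2\<close> to meet the one at \<open>k\<close>.\<close>
    let ?F = "insert (axis j 1) F"
    have "card ?F \<le> card F + 1" using F(1) by (simp add: card_insert_if)
    then have "card ?F < card H" using F(2) by linarith
    moreover have "finite ?F" using F(1) by simp
    ultimately obtain u2 where u2: "u2 \<noteq> 0" "\<forall>i. i \<notin> H \<longrightarrow> u2 $ i = 0" "\<forall>f\<in>?F. f \<bullet> u2 = 0"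
      using exists_supported_orthogonal by metis
    have u2j: "u2 $ j = 0" using u2(3) by (simp add: inner_axis')
    obtain k where k: "u2 $ k \<noteq> 0" using u2(1) by (auto simp: vec_eq_iff)
    then have "k \<in> H" using u2(2) by auto
    show ?thesis
    proof (cases "v $ j = 0")
      case True
      \<comment> \<open>The combination of \<open>u1\<close> and \<open>u2\<close> could be zero
        here, so \<open>u2\<close> alone is taken with \<open>j\<close> in both roles: both points
        vanish at \<open>j\<close>.\<close>
      then show ?thesis using collide[of u2 j j] u2 u2j \<open>j \<in> H\<close> by simp
    next
      case False
      define \<alpha> where "\<alpha> = - v $ j / u1 $ j"
      define u where "u = \<alpha> *\<^sub>R u1 + ((v $ k - \<alpha> * u1 $ k) / u2 $ k) *\<^sub>R u2"
      have uj: "u $ j = - v $ j" using j u2j by (simp add: u_def \<alpha>_def)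
      have uk: "u $ k = v $ k" using k by (simp add: u_def)
      have "u \<noteq> 0" using uj False by auto
      then show ?thesis
        by (rule collide[OF _ _ _ \<open>j \<in> H\<close> \<open>k \<in> H\<close> uj uk])
          (use u1 u2 in \<open>auto simp: u_def inner_right_distrib\<close>)
    qed
  qed
qed

theorem theorem2p5:
  shows "(\<forall>(s::nat) (A::real^'d^'m) (b::real^'m).
            1 \<le> s \<and> s \<le> CARD('d) - 1 \<and> sparse_affine_pr s A b \<longrightarrow> CARD('m) \<ge> 2 * s + 1)
       \<and> (\<forall>s::nat. CARD('m) \<ge> 2 * s + 1 \<longrightarrow>
            generic (\<lambda>(A::real^'d^'m, b::real^'m). sparse_affine_pr s A b))"
proof (intro conjI allI impI)
  fix s and A :: "real^'d^'m" and b :: "real^'m"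
  assume *: "1 \<le> s \<and> s \<le> CARD('d) - 1 \<and> sparse_affine_pr s A b"
  then have "s < CARD('d)" by linarith
  then show "CARD('m) \<ge> 2 * s + 1"
    using not_sparse_affine_pr[of s A b] * by linarith
qed (rule generic_sparse_affine_pr)

end
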